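(* Let $G$ be a topological group and $X$ a nonempty $G$-space. Let $G_\lambda$ be the $G$-space $G$ with the action by left translation. If $$\operatorname{Hom}_G(X,G_\lambda)\neq\emptyset$$ and $X$ has a $G$-equivariant Moore approximation of degree $k>0$, then $$k-1\ge\operatorname{Hdim}(G).$$
   Context: All homology groups have rational coefficients. A $G$-space is a topological space $X$ with a continuous homomorphism $\rho_X:G\to\operatorname{Homeo}(X)$, i.e. a continuous action of $G$, written $g\cdot x$; $\operatorname{Hom}_G(X,Y)$ is the set of continuous $G$-equivariant maps $X\to Y$. A $G$-equivariant Moore approximation of degree $k\ge0$ of a $G$-space $X$ is a $G$-space $X_{<k}$ with a continuous $G$-equivariant map $f_{<k}:X_{<k}\to X$ such that $H_r(f_{<k}):H_r(X_{<k})\to H_r(X)$ is an isomorphism for all $r<k$ and $H_r(X_{<k})=0$ for all $r\ge k$. The homological dimension of a nonempty space $Y$ is $\operatorname{Hdim}(Y)=\min\{n\in\mathbb{Z}: H_m(Y)=0\text{ for all }m>n\}$ if such $n$ exists, and infinite otherwise. *)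

theory Defs
  imports "HOL-Homology.Homology" "HOL-Algebra.Group_Action" "HOL-Library.Extended"
begin

section \<open>Singular homology with rational coefficients\<close>

text \<open>
  HOL-Homology provides singular homology with integer coefficients only. The definitions below
  follow its chain complex, reusing singular simplices and their faces, with coefficients in the
  rational numbers.
\<close>

type_synonym 'a qchain = "((nat \<Rightarrow> real) \<Rightarrow> 'a) \<Rightarrow>\<^sub>0 rat"

definition qchains :: "nat \<Rightarrow> 'a topology \<Rightarrow> 'a qchain set"
  where "qchains p X = {c. Poly_Mapping.keys c \<subseteq> singular_simplex_set p X}"

definition qchain_boundary :: "nat \<Rightarrow> 'a qchain \<Rightarrow> 'a qchain"
  where "qchain_boundary p c =
    (if p = 0 then 0
     else \<Sum>s\<in>Poly_Mapping.keys c. \<Sum>i\<le>p.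
            Poly_Mapping.single (singular_face p i s) ((-1) ^ i * Poly_Mapping.lookup c s))"

definition qchain_map :: "nat \<Rightarrow> ('a \<Rightarrow> 'b) \<Rightarrow> 'a qchain \<Rightarrow> 'b qchain"
  where "qchain_map p f c =
    (\<Sum>s\<in>Poly_Mapping.keys c.
       Poly_Mapping.single (simplex_map p f s) (Poly_Mapping.lookup c s))"

definition qcycle_group :: "nat \<Rightarrow> 'a topology \<Rightarrow> 'a qchain monoid"
  where "qcycle_group p X =
    \<lparr>carrier = {c \<in> qchains p X. qchain_boundary p c = 0}, monoid.mult = (+), one = 0\<rparr>"

definition qboundaries :: "nat \<Rightarrow> 'a topology \<Rightarrow> 'a qchain set"
  where "qboundaries p X = qchain_boundary (Suc p) ` qchains (Suc p) X"

text \<open>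
  The index is a natural number; homology in negative degrees is zero. Only the additive group of
  the rational vector space is recorded: the induced maps are linear over the rationals, so they
  are isomorphisms of vector spaces if and only if they are isomorphisms of groups.
\<close>

definition qhomology_group :: "nat \<Rightarrow> 'a topology \<Rightarrow> 'a qchain set monoid"
  where "qhomology_group p X = qcycle_group p X Mod qboundaries p X"

text \<open>
  For continuous \<open>f\<close> and a homology class \<open>C\<close>, the cosets united here all coincide, and the union
  is the class of \<open>f\<^sub># c\<close> for any representative \<open>c\<close> of \<open>C\<close>.
\<close>

definition qhom_induced ::
    "nat \<Rightarrow> 'a topology \<Rightarrow> 'b topology \<Rightarrow> ('a \<Rightarrow> 'b) \<Rightarrow> 'a qchain set \<Rightarrow> 'b qchain set"
  where "qhom_induced p X Y f C =
    (\<Union>c\<in>C. qboundaries p Y #>\<^bsub>qcycle_group p Y\<^esub> qchain_map p f c)"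

text \<open>
  As homology in negative degrees is zero, quantifying over natural \<open>m\<close> in the condition below is
  the same as quantifying over integers. The minimum exists for nonempty \<open>Y\<close>, where the zeroth
  homology is nonzero; the notion is only meant for such \<open>Y\<close>.
\<close>

definition Hdim :: "'a topology \<Rightarrow> int extended"
  where "Hdim Y =
    (if \<exists>n::int. \<forall>m::nat. int m > n \<longrightarrow> trivial_group (qhomology_group m Y)
     then Fin (LEAST n::int. \<forall>m::nat. int m > n \<longrightarrow> trivial_group (qhomology_group m Y))
     else Pinf)"


section \<open>Topological groups and equivariant maps\<close>

locale topological_group = group G for G (structure) +
  fixes T :: "'a topology"
  assumes topspace_eq: "topspace T = carrier G"
    and continuous_mult: "continuous_map (prod_topology T T) T (\<lambda>(x, y). x \<otimes> y)"
    and continuous_inv: "continuous_map T T (\<lambda>x. inv x)"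

text \<open>
  Each \<open>\<rho> g\<close> is a bijection of the underlying set of \<open>X\<close>, by \<^const>\<open>group_action\<close>; it is a
  homeomorphism by joint continuity of the action.
\<close>

locale G_space = topological_group G T + group_action G "topspace X" \<rho>
  for G (structure) and T and X :: "'x topology" and \<rho> +
  assumes continuous_action: "continuous_map (prod_topology T X) X (\<lambda>(g, x). \<rho> g x)"

definition left_translation :: "('g, 'm) monoid_scheme \<Rightarrow> 'g \<Rightarrow> 'g \<Rightarrow> 'g"
  where "left_translation G g = (\<lambda>h\<in>carrier G. g \<otimes>\<^bsub>G\<^esub> h)"

definition Hom_G ::
    "('g, 'm) monoid_scheme \<Rightarrow> 'x topology \<Rightarrow> ('g \<Rightarrow> 'x \<Rightarrow> 'x) \<Rightarrow>
     'y topology \<Rightarrow> ('g \<Rightarrow> 'y \<Rightarrow> 'y) \<Rightarrow> ('x \<Rightarrow> 'y) set"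
  where "Hom_G G X \<rho> Y \<sigma> =
    {f. continuous_map X Y f \<and> (\<forall>g\<in>carrier G. \<forall>x\<in>topspace X. f (\<rho> g x) = \<sigma> g (f x))}"

text \<open>\<open>(A, \<alpha>)\<close> with the map \<open>f\<close> is an equivariant Moore approximation of degree \<open>k\<close> of \<open>(X, \<rho>)\<close>.\<close>

definition equivariant_Moore_approximation ::
    "('g, 'm) monoid_scheme \<Rightarrow> 'g topology \<Rightarrow> 'x topology \<Rightarrow> ('g \<Rightarrow> 'x \<Rightarrow> 'x) \<Rightarrow> nat \<Rightarrow>
     'a topology \<Rightarrow> ('g \<Rightarrow> 'a \<Rightarrow> 'a) \<Rightarrow> ('a \<Rightarrow> 'x) \<Rightarrow> bool"
  where "equivariant_Moore_approximation G T X \<rho> k A \<alpha> f \<longleftrightarrow>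
    G_space G T A \<alpha> \<and>
    f \<in> Hom_G G A \<alpha> X \<rho> \<and>
    (\<forall>r<k. qhom_induced r A X f \<in> iso (qhomology_group r A) (qhomology_group r X)) \<and>
    (\<forall>r\<ge>k. trivial_group (qhomology_group r A))"

end

theory Submission
  imports Defs
begin

text \<open>
  Let \<open>\<phi> : X \<rightarrow> G\<close> be equivariant and \<open>f : A \<rightarrow> X\<close> the Moore approximation. As \<open>k > 0\<close>, we have
  \<open>H\<^sub>0(A) \<cong> H\<^sub>0(X) \<noteq> 0\<close>, so there is a point \<open>a\<close> of \<open>A\<close>. The equivariant map \<open>\<phi> \<circ> f\<close> sends \<open>g \<cdot> a\<close> to
  \<open>g h\<close> with \<open>h = \<phi> (f a)\<close>; followed by right translation by the inverse of \<open>h\<close> it is a left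
  inverse of the orbit map \<open>g \<mapsto> g \<cdot> a\<close>. Hence \<open>G\<close> is a retract of \<open>A\<close>, and its homology vanishes
  wherever that of \<open>A\<close> does.
\<close>

section \<open>Rational chains\<close>

text \<open>Padding all three sums with zeros to the union \<open>K\<close> of the supports lets
  additivity of \<open>h s\<close> act term by term, even where coefficients cancel in
  \<open>c + d\<close>. The boundary, the induced chain map and the augmentation are all sums of
  this form.\<close>

lemma sum_keys_add:
  fixes h :: "'b \<Rightarrow> 'c::comm_monoid_add \<Rightarrow> 'd::comm_monoid_add"
  assumes zero: "\<And>s. h s 0 = 0" and add: "\<And>s a b. h s (a + b) = h s a + h s b"
  shows "(\<Sum>s\<in>Poly_Mapping.keys (c + d). h s (Poly_Mapping.lookup (c + d) s)) =
    (\<Sum>s\<in>Poly_Mapping.keys c. h s (Poly_Mapping.lookup c s)) +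
    (\<Sum>s\<in>Poly_Mapping.keys d. h s (Poly_Mapping.lookup d s))"
proof -
  define K where "K = Poly_Mapping.keys c \<union> Poly_Mapping.keys d"
  have *: "(\<Sum>s\<in>Poly_Mapping.keys e. h s (Poly_Mapping.lookup e s)) =
      (\<Sum>s\<in>K. h s (Poly_Mapping.lookup e s))" if "Poly_Mapping.keys e \<subseteq> K" for e
    using that by (intro sum.mono_neutral_left) (auto simp: K_def zero in_keys_iff)
  have keys: "Poly_Mapping.keys (c + d) \<subseteq> K" "Poly_Mapping.keys c \<subseteq> K" "Poly_Mapping.keys d \<subseteq> K"
    using Poly_Mapping.keys_add[of c d] by (auto simp: K_def)
  show ?thesis
    unfolding keys[THEN *] by (simp add: lookup_add add sum.distrib)
qed

text \<open>A chain is the finite sum of its one-simplex terms, so a property closed under addition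
  need only be checked on these. The bound \<open>S\<close> on the support retains the information
  that each simplex is singular in the given space.\<close>

lemma poly_mapping_additive_induct [consumes 1, case_names zero single add]:
  fixes c :: "'b \<Rightarrow>\<^sub>0 'c::comm_monoid_add"
  assumes "Poly_Mapping.keys c \<subseteq> S" and "P 0"
    and single: "\<And>s q. s \<in> S \<Longrightarrow> P (Poly_Mapping.single s q)"
    and add: "\<And>a b. P a \<Longrightarrow> P b \<Longrightarrow> P (a + b)"
  shows "P c"
proof -
  have "P (\<Sum>s\<in>K. Poly_Mapping.single s (Poly_Mapping.lookup c s))"
    if "finite K" "K \<subseteq> S" for K
    using that by (induction K rule: finite_induct) (auto simp: assms)
  moreover have "(\<Sum>s\<in>Poly_Mapping.keys c. Poly_Mapping.single s (Poly_Mapping.lookup c s)) = c"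
    by (rule poly_mapping_eqI) (auto simp: lookup_sum lookup_single when_def in_keys_iff)
  ultimately show ?thesis
    using assms(1) by (metis finite_keys)
qed

section \<open>Additivity and naturality of the boundary and of induced chain maps\<close>

lemma qchain_boundary_0 [simp]: "qchain_boundary p 0 = 0"
  by (simp add: qchain_boundary_def)

lemma qchain_map_0 [simp]: "qchain_map p f 0 = 0"
  by (simp add: qchain_map_def)

lemma qchain_boundary_add:
  "qchain_boundary p (c + d) = qchain_boundary p c + qchain_boundary p d"
proof (cases "p = 0")
  case False
  define h :: "((nat \<Rightarrow> real) \<Rightarrow> 'a) \<Rightarrow> rat \<Rightarrow> 'a qchain" where
    "h s q = (\<Sum>i\<le>p. Poly_Mapping.single (singular_face p i s) ((-1) ^ i * q))" for s q
  have "qchain_boundary p e = (\<Sum>s\<in>Poly_Mapping.keys e. h s (Poly_Mapping.lookup e s))" for e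
    using False by (simp add: qchain_boundary_def h_def)
  moreover have "h s (a + b) = h s a + h s b" "h s 0 = 0" for s a b
    by (simp_all add: h_def distrib_left single_add sum.distrib)
  ultimately show ?thesis
    by (simp add: sum_keys_add)
qed (simp add: qchain_boundary_def)

lemma qchain_map_add: "qchain_map p f (c + d) = qchain_map p f c + qchain_map p f d"
  unfolding qchain_map_def
  using sum_keys_add[of "\<lambda>s. Poly_Mapping.single (simplex_map p f s)" c d]
  by (simp add: single_add)

lemma qchain_boundary_single:
  assumes "p > 0"
  shows "qchain_boundary p (Poly_Mapping.single s q) =
    (\<Sum>i\<le>p. Poly_Mapping.single (singular_face p i s) ((-1) ^ i * q))"
  \<comment> \<open>A zero coefficient leaves an empty support, so it is treated apart.\<close>
  using assms by (cases "q = 0") (simp_all add: qchain_boundary_def)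

lemma qchain_map_single:
  "qchain_map p f (Poly_Mapping.single s q) = Poly_Mapping.single (simplex_map p f s) q"
  by (cases "q = 0") (simp_all add: qchain_map_def)

lemma qchain_map_sum: "qchain_map p f (sum g I) = (\<Sum>i\<in>I. qchain_map p f (g i))"
  by (induction I rule: infinite_finite_induct) (auto simp: qchain_map_add)

lemma qchain_map_in_qchains:
  assumes "c \<in> qchains p X" "continuous_map X Y f"
  shows "qchain_map p f c \<in> qchains p Y"
proof -
  have "Poly_Mapping.keys c \<subseteq> singular_simplex_set p X"
    using assms(1) by (simp add: qchains_def)
  then show ?thesis
  proof (induction c rule: poly_mapping_additive_induct)
    case (single s q)
    then show ?case
      using singular_simplex_simplex_map[OF _ assms(2)] by (simp add: qchain_map_single qchains_def)
  next
    case (add a b)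
    then show ?case
      using Poly_Mapping.keys_add by (fastforce simp: qchain_map_add qchains_def)
  qed (simp add: qchains_def)
qed

text \<open>Composing a simplex with \<open>f\<close> commutes with restricting it to a face. In
  degree 0 both sides vanish, so the truncated \<open>p - 1\<close> is harmless there.\<close>

lemma qchain_boundary_map:
  assumes "c \<in> qchains p X"
  shows "qchain_boundary p (qchain_map p f c) = qchain_map (p - 1) f (qchain_boundary p c)"
proof (cases "p = 0")
  case False
  have "Poly_Mapping.keys c \<subseteq> singular_simplex_set p X"
    using assms by (simp add: qchains_def)
  then show ?thesis
  proof (induction c rule: poly_mapping_additive_induct)
    case (single s q)
    have "singular_face p i (simplex_map p f s) = simplex_map (p - 1) f (singular_face p i s)"
      if "i \<le> p" for i
      using that False
      by (simp add: singular_face_simplex_map)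
        (auto simp: singular_face_def simplex_map_def fun_eq_iff)
    then show ?case
      using False
      by (simp add: qchain_map_single qchain_boundary_single qchain_map_sum)
  qed (simp_all add: qchain_boundary_add qchain_map_add)
qed (simp add: qchain_boundary_def)

text \<open>Every simplex in the support of \<open>c\<close> takes values in
  \<open>topspace X\<close>, where \<open>g \<circ> f\<close> is the identity.\<close>

lemma qchain_map_left_inverse:
  assumes "c \<in> qchains p X" "\<And>x. x \<in> topspace X \<Longrightarrow> g (f x) = x"
  shows "qchain_map p g (qchain_map p f c) = c"
proof -
  have "Poly_Mapping.keys c \<subseteq> singular_simplex_set p X"
    using assms(1) by (simp add: qchains_def)
  then show ?thesis
  proof (induction c rule: poly_mapping_additive_induct)
    case (single s q)
    then have "simplex_map p (g \<circ> f) s = s"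
      using assms(2) by (intro simplex_map_id_gen[of p X]) auto
    then show ?case
      by (simp add: qchain_map_single simplex_map_compose)
  qed (simp_all add: qchain_map_add)
qed


section \<open>Vanishing of rational homology\<close>

lemma zero_in_qboundaries: "0 \<in> qboundaries p X"
  unfolding qboundaries_def
  by (rule image_eqI[of _ _ 0]) (auto simp: qchains_def)

lemma add_in_qboundaries:
  assumes "a \<in> qboundaries p X" "b \<in> qboundaries p X"
  shows "a + b \<in> qboundaries p X"
proof -
  obtain c d where "c \<in> qchains (Suc p) X" "d \<in> qchains (Suc p) X"
    "a = qchain_boundary (Suc p) c" "b = qchain_boundary (Suc p) d"
    using assms by (auto simp: qboundaries_def)
  moreover from this have "c + d \<in> qchains (Suc p) X"
    using Poly_Mapping.keys_add[of c d] by (auto simp: qchains_def)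
  ultimately show ?thesis
    unfolding qboundaries_def by (metis qchain_boundary_add image_eqI)
qed

lemma uminus_in_qboundaries:
  assumes "a \<in> qboundaries p X"
  shows "- a \<in> qboundaries p X"
proof -
  obtain c where c: "c \<in> qchains (Suc p) X" "a = qchain_boundary (Suc p) c"
    using assms by (auto simp: qboundaries_def)
  have "qchain_boundary (Suc p) (- c) = - a"
    using qchain_boundary_add[of "Suc p" c "- c"] c(2) by (simp add: minus_unique)
  moreover have "- c \<in> qchains (Suc p) X"
    using c(1) by (simp add: qchains_def)
  ultimately show ?thesis
    unfolding qboundaries_def by (metis image_eqI)
qed

lemma carrier_qhomology_group:
  "carrier (qhomology_group p X) = (\<lambda>c. (\<lambda>b. b + c) ` qboundaries p X) ` carrier (qcycle_group p X)"
  by (auto simp: qhomology_group_def FactGroup_def RCOSETS_def r_coset_def qcycle_group_def)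

lemma qboundaries_in_carrier: "qboundaries p X \<in> carrier (qhomology_group p X)"
  unfolding carrier_qhomology_group
  by (rule image_eqI[of _ _ 0]) (auto simp: qcycle_group_def qchains_def)

text \<open>The classes of \<open>c\<close> and \<open>0\<close> must coincide, and the former
  contains \<open>c\<close>. Only the carrier is mentioned, so that a one-element carrier
  transported along a bijection satisfies the assumption directly.\<close>

lemma carrier_qhomology_singleton_imp:
  assumes "carrier (qhomology_group p X) = {C}"
  shows "carrier (qcycle_group p X) \<subseteq> qboundaries p X"
proof
  fix c assume "c \<in> carrier (qcycle_group p X)"
  then have "(\<lambda>b. b + c) ` qboundaries p X \<in> {C}" "qboundaries p X \<in> {C}"
    using assms qboundaries_in_carrier[of p X] by (auto simp flip: assms simp: carrier_qhomology_group)
  then have "(\<lambda>b. b + c) ` qboundaries p X = qboundaries p X"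
    by simp
  then show "c \<in> qboundaries p X"
    using zero_in_qboundaries[of p X] by (metis add_0 image_eqI)
qed

text \<open>For the converse direction, translation by a boundary permutes the boundaries, so every
  class equals \<open>?B\<close>; the group laws are then checked by hand on this single
  element.\<close>

lemma trivial_qhomology_group_iff:
  "trivial_group (qhomology_group p X) \<longleftrightarrow> carrier (qcycle_group p X) \<subseteq> qboundaries p X"
proof
  assume "trivial_group (qhomology_group p X)"
  then show "carrier (qcycle_group p X) \<subseteq> qboundaries p X"
    by (metis carrier_qhomology_singleton_imp trivial_group_def)
next
  let ?B = "qboundaries p X" and ?H = "qhomology_group p X"
  assume *: "carrier (qcycle_group p X) \<subseteq> ?B"
  have "(\<lambda>b. b + c) ` ?B = ?B" if "c \<in> ?B" for c
  proof
    show "?B \<subseteq> (\<lambda>b. b + c) ` ?B"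
    proof
      fix b assume "b \<in> ?B"
      then have "b + - c \<in> ?B"
        using that by (intro add_in_qboundaries uminus_in_qboundaries)
      then show "b \<in> (\<lambda>b. b + c) ` ?B"
        by (rule image_eqI[rotated]) simp
    qed
  qed (use that add_in_qboundaries in auto)
  then have car: "carrier ?H = {?B}"
    using * qboundaries_in_carrier[of p X] by (auto simp: carrier_qhomology_group)
  have one: "\<one>\<^bsub>?H\<^esub> = ?B"
    by (simp add: qhomology_group_def FactGroup_def)
  have "?B <#>\<^bsub>qcycle_group p X\<^esub> ?B = ?B"
  proof
    show "?B \<subseteq> ?B <#>\<^bsub>qcycle_group p X\<^esub> ?B"
      using zero_in_qboundaries[of p X] by (force simp: set_mult_def qcycle_group_def)
  qed (auto simp: set_mult_def qcycle_group_def add_in_qboundaries)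
  then have "?B \<otimes>\<^bsub>?H\<^esub> ?B = ?B"
    by (simp add: qhomology_group_def FactGroup_def)
  then have "group ?H"
    by (intro groupI) (auto simp: car one)
  then show "trivial_group ?H"
    by (simp add: trivial_group_def car one)
qed

text \<open>If \<open>f\<close> sends a cycle \<open>c\<close> to the boundary of \<open>d\<close>,
  then applying \<open>g\<close> exhibits \<open>c\<close> as the boundary of the image of
  \<open>d\<close>.\<close>

lemma trivial_qhomology_group_retract:
  assumes "trivial_group (qhomology_group p Y)"
    and f: "continuous_map X Y f" and g: "continuous_map Y X g"
    and gf: "\<And>x. x \<in> topspace X \<Longrightarrow> g (f x) = x"
  shows "trivial_group (qhomology_group p X)"
  unfolding trivial_qhomology_group_iff
proof
  fix c assume "c \<in> carrier (qcycle_group p X)"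
  then have c: "c \<in> qchains p X" "qchain_boundary p c = 0"
    by (auto simp: qcycle_group_def)
  then have "qchain_map p f c \<in> carrier (qcycle_group p Y)"
    by (simp add: qcycle_group_def qchain_map_in_qchains[OF _ f] qchain_boundary_map)
  then have "qchain_map p f c \<in> qboundaries p Y"
    using assms(1) trivial_qhomology_group_iff by blast
  then obtain d where d: "d \<in> qchains (Suc p) Y" "qchain_map p f c = qchain_boundary (Suc p) d"
    by (auto simp: qboundaries_def)
  have "qchain_boundary (Suc p) (qchain_map (Suc p) g d) = qchain_map p g (qchain_map p f c)"
    using d by (simp add: qchain_boundary_map)
  also have "\<dots> = c"
    using c(1) gf by (rule qchain_map_left_inverse)
  finally show "c \<in> qboundaries p X"
    unfolding qboundaries_def using qchain_map_in_qchains[OF d(1) g] by (metis image_eqI)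
qed

text \<open>Without singular simplices the only chain is \<open>0\<close>, which is a
  boundary.\<close>

lemma trivial_qhomology_group_empty:
  assumes "topspace X = {}"
  shows "trivial_group (qhomology_group p X)"
proof -
  have "carrier (qcycle_group p X) \<subseteq> {0}"
    using singular_simplex_empty[OF assms] by (auto simp: qcycle_group_def qchains_def subset_iff simp flip: keys_eq_empty)
  then show ?thesis
    using zero_in_qboundaries[of p X] by (auto simp: trivial_qhomology_group_iff)
qed

text \<open>The two faces of a 1-simplex enter with opposite signs, so the augmentation, the sum of
  all coefficients, kills boundaries. This is the invariant that detects homology in degree
  0.\<close>

lemma sum_lookup_qchain_boundary_1:
  "(\<Sum>s\<in>Poly_Mapping.keys (qchain_boundary 1 c). Poly_Mapping.lookup (qchain_boundary 1 c) s) = 0"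
proof -
  define aug :: "'a qchain \<Rightarrow> rat" where
    "aug e = (\<Sum>s\<in>Poly_Mapping.keys e. Poly_Mapping.lookup e s)" for e
  have aug_add: "aug (a + b) = aug a + aug b" for a b
    unfolding aug_def by (rule sum_keys_add) auto
  have aug_single: "aug (Poly_Mapping.single s q) = q" for s q
    by (cases "q = 0") (simp_all add: aug_def)
  have "Poly_Mapping.keys c \<subseteq> UNIV"
    by simp
  then have "aug (qchain_boundary 1 c) = 0"
  proof (induction c rule: poly_mapping_additive_induct)
    case zero
    show ?case by (simp add: aug_def)
  qed (simp_all add: qchain_boundary_add qchain_boundary_single aug_add aug_single)
  then show ?thesis
    by (simp add: aug_def)
qed

lemma zeroth_qcycles_not_subset_qboundaries:
  assumes "topspace X \<noteq> {}"
  shows "\<not> carrier (qcycle_group 0 X) \<subseteq> qboundaries 0 X"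
proof
  assume *: "carrier (qcycle_group 0 X) \<subseteq> qboundaries 0 X"
  obtain x where "x \<in> topspace X"
    using assms by blast
  \<comment> \<open>The constant 0-simplex at \<open>x\<close>; with coefficient 1 it is a cycle of
    augmentation 1, hence no boundary.\<close>
  define s where "s = (\<lambda>t\<in>standard_simplex 0. x)"
  define c :: "'a qchain" where "c = Poly_Mapping.single s 1"
  have "singular_simplex 0 X s"
    using \<open>x \<in> topspace X\<close> by (simp add: singular_simplex_def s_def)
  then have "c \<in> carrier (qcycle_group 0 X)"
    by (simp add: qcycle_group_def qchains_def c_def qchain_boundary_def)
  then obtain d where "c = qchain_boundary 1 d"
    using * by (auto simp: qboundaries_def)
  then have "(\<Sum>s\<in>Poly_Mapping.keys c. Poly_Mapping.lookup c s) = 0"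
    using sum_lookup_qchain_boundary_1[of d] by simp
  then show False
    by (simp add: c_def)
qed

lemma Hdim_le:
  assumes "topspace Y \<noteq> {}"
    and "\<And>m::nat. int m > n \<Longrightarrow> trivial_group (qhomology_group m Y)"
  shows "Hdim Y \<le> Fin n"
proof -
  define P where "P n \<longleftrightarrow> (\<forall>m::nat. int m > n \<longrightarrow> trivial_group (qhomology_group m Y))" for n :: int
  have nonneg: "n' \<ge> 0" if "P n'" for n'
  proof (rule ccontr)
    assume "\<not> n' \<ge> 0"
    with that have "trivial_group (qhomology_group 0 Y)"
      by (simp add: P_def)
    then show False
      using zeroth_qcycles_not_subset_qboundaries[OF assms(1)]
      by (simp add: trivial_qhomology_group_iff)
  qed
  have "P n"
    using assms(2) by (simp add: P_def)
  \<comment> \<open>A nonempty set of integers may lack a least element. Since \<open>P\<close>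
    fails at negative numbers, the minimum can be taken over the naturals and carried back by
    \<open>int\<close>.\<close>
  define l where "l = int (LEAST j. P (int j))"
  have "P (int (nat n))"
    using \<open>P n\<close> nonneg by simp
  then have "P l"
    unfolding l_def by (rule LeastI)
  moreover have l_le: "l \<le> n'" if "P n'" for n'
  proof -
    have "(LEAST j. P (int j)) \<le> nat n'"
      using that nonneg[OF that] by (intro Least_le) simp
    then show ?thesis
      using nonneg[OF that] by (simp add: l_def)
  qed
  ultimately have "(LEAST n. P n) = l"
    by (intro Least_equality)
  then have "(LEAST n. P n) \<le> n"
    using l_le[OF \<open>P n\<close>] by simp
  then show ?thesis
    using \<open>P n\<close> unfolding Hdim_def P_def by auto
qed


section \<open>The group as a retract of the Moore approximation\<close>

text \<open>As \<open>k > 0\<close>, degree 0 is among those where \<open>f\<close> induces a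
  bijection, which would carry the one-element homology of an empty \<open>A\<close> over to the
  nonempty \<open>X\<close>.\<close>

lemma Moore_approximation_nonempty:
  assumes "equivariant_Moore_approximation G T X \<rho> k A \<alpha> f" "k > 0" "topspace X \<noteq> {}"
  shows "topspace A \<noteq> {}"
proof
  assume "topspace A = {}"
  then have "trivial_group (qhomology_group 0 A)"
    by (rule trivial_qhomology_group_empty)
  then obtain C where "carrier (qhomology_group 0 A) = {C}"
    by (auto simp: trivial_group_def)
  moreover have "qhom_induced 0 A X f \<in> iso (qhomology_group 0 A) (qhomology_group 0 X)"
    using assms by (simp add: equivariant_Moore_approximation_def)
  ultimately have "carrier (qhomology_group 0 X) = {qhom_induced 0 A X f C}"
    by (auto simp: iso_def bij_betw_def)
  then show False
    using zeroth_qcycles_not_subset_qboundaries[OF assms(3)] carrier_qhomology_singleton_imp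
    by blast
qed

section \<open>Continuity of right translations and orbit maps\<close>

lemma (in topological_group) continuous_right_translation:
  assumes "h \<in> carrier G"
  shows "continuous_map T T (\<lambda>x. x \<otimes> h)"
proof -
  have "continuous_map T (prod_topology T T) (\<lambda>x. (x, h))"
    using assms by (simp add: continuous_map_pairwise o_def topspace_eq)
  from continuous_map_compose[OF this continuous_mult] show ?thesis
    by (simp add: o_def)
qed

lemma (in G_space) continuous_orbit_map:
  assumes "x \<in> topspace X"
  shows "continuous_map T X (\<lambda>g. \<rho> g x)"
proof -
  have "continuous_map T (prod_topology T X) (\<lambda>g. (g, x))"
    using assms by (simp add: continuous_map_pairwise o_def)
  from continuous_map_compose[OF this continuous_action] show ?thesis
    by (simp add: o_def)
qed

theorem proposition3p7:
  fixes G :: "('g, 'm) monoid_scheme" and T :: "'g topology"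
    and X :: "'x topology" and \<rho> :: "'g \<Rightarrow> 'x \<Rightarrow> 'x" and k :: nat
  assumes "topological_group G T"
    and "G_space G T X \<rho>"
    and "topspace X \<noteq> {}"
    and "Hom_G G X \<rho> T (left_translation G) \<noteq> {}"
    and "k > 0"
    and "\<exists>(A :: 'a topology) \<alpha> f. equivariant_Moore_approximation G T X \<rho> k A \<alpha> f"
  shows "Fin (int k - 1) \<ge> Hdim T"
proof -
  interpret topological_group G T by fact
  obtain A :: "'a topology" and \<alpha> f where M: "equivariant_Moore_approximation G T X \<rho> k A \<alpha> f"
    using assms(6) by blast
  obtain \<phi> where \<phi>: "continuous_map X T \<phi>"
      "\<And>g x. g \<in> carrier G \<Longrightarrow> x \<in> topspace X \<Longrightarrow> \<phi> (\<rho> g x) = left_translation G g (\<phi> x)"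
    using assms(4) by (auto simp: Hom_G_def)
  have f: "continuous_map A X f"
      "\<And>g a. g \<in> carrier G \<Longrightarrow> a \<in> topspace A \<Longrightarrow> f (\<alpha> g a) = \<rho> g (f a)"
    using M by (auto simp: equivariant_Moore_approximation_def Hom_G_def)
  interpret A: G_space G T A \<alpha>
    using M by (simp add: equivariant_Moore_approximation_def)
  obtain a where a: "a \<in> topspace A"
    using Moore_approximation_nonempty[OF M assms(5,3)] by blast
  define h where "h = \<phi> (f a)"
  have fa: "f a \<in> topspace X"
    using f(1) a by (auto simp: continuous_map_def)
  then have h: "h \<in> carrier G"
    using \<phi>(1) by (auto simp: h_def continuous_map_def simp flip: topspace_eq)
  \<comment> \<open>Right multiplication by the inverse of \<open>h\<close> normalises
    \<open>\<phi> \<circ> f\<close> so that \<open>a\<close> goes to the identity, while left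
    equivariance is kept.\<close>
  define r where "r = (\<lambda>x. x \<otimes>\<^bsub>G\<^esub> inv\<^bsub>G\<^esub> h) \<circ> (\<phi> \<circ> f)"
  have "continuous_map A T r"
    unfolding r_def
    using f(1) \<phi>(1) h by (intro continuous_map_compose[of A T] continuous_map_compose[of A X]
        continuous_right_translation inv_closed)
  moreover have "r (\<alpha> g a) = g" if "g \<in> topspace T" for g
    using that a fa h
    by (simp add: r_def f \<phi> left_translation_def topspace_eq m_assoc flip: h_def)
  ultimately have "trivial_group (qhomology_group m T)" if "m \<ge> k" for m
    using M that A.continuous_orbit_map[OF a]
    by (intro trivial_qhomology_group_retract[of m A T "\<lambda>g. \<alpha> g a" r])
      (auto simp: equivariant_Moore_approximation_def)
  then show ?thesis
    \<comment> \<open>The identity is a point of \<open>T\<close>, and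
      \<open>int m > int k - 1\<close> says exactly that \<open>m \<ge> k\<close>.\<close>
    using one_closed by (intro Hdim_le) (auto simp: topspace_eq)
qed

end
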